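(* Let $\mathscr C_\infty=[\mathcal X/\langle\alpha\rangle]$ be the archimedean equivariant topos over $\mathbf F_{1^2}$ and identify $\mathscr C_\infty(\mathbf C)=\mathcal X(\mathbf C)/\langle\alpha\rangle$ with $\mathbb P^1(\mathbf C)=\mathbf C\cup\{\infty\}$ by the canonical bijection. The odd arithmetic monoid $\mathbf N^\times_{\mathrm{odd}}$ (odd positive integers under multiplication), acting through the Frobenius endomorphisms $\mathrm{Fr}_n(x)=x^n$ of the structure sheaf, acts on $\mathscr C_\infty(\mathbf C)$ via $$\mathrm{Fr}_n(z)=\begin{cases} z^n & \text{if } n\equiv1\pmod 4,\\[2pt] -\dfrac1{z^n} & \text{if } n\equiv3\pmod 4.\end{cases}$$ Furthermore, this action commutes with the quaternionic real structure $\sigma(z)=-1/\bar z$.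
   Context: **Spherical algebras.** For a commutative pointed monoid $M$ (absorbing $0$, unit $1$), $\mathbf F_1[M]$ is its spherical algebra. For a commutative ring $R$, $HR$ denotes the Eilenberg–MacLane $\mathbf F_1$-algebra; homomorphisms $\mathbf F_1[M]\to HR$ are the same as multiplicative maps $M\to R$ preserving $0$ and $1$. Let $\mathbf F_{1^2}:=\mathbf F_1[\{0,1,\epsilon:\epsilon^2=1\}]$; $HR$ is an $\mathbf F_{1^2}$-algebra via $\epsilon\mapsto-1_R$, and homomorphisms of $\mathbf F_{1^2}$-algebras to $HR$ send $\epsilon$ to $-1_R$. **The space $\mathcal X$.** The underlying space has two closed points $+,-$ and a generic point $\eta$, with nontrivial opens $\Omega_\pm=\{\pm,\eta\}$, $\Omega=\{\eta\}$. The structure sheaf is $$\mathcal O(\Omega_+)=\mathbf F_{1^2}[T^{\mathbf Z_{\ge0}},J_+]/(J_+^2=\epsilon),\quad \mathcal O(\Omega_-)=\mathbf F_{1^2}[T^{\mathbf Z_{\le0}},J_-]/(J_-^2=\epsilon),\quad \mathcal O(\Omega)=\mathbf F_{1^2}[T^{\mathbf Z},J]/(J^2=\epsilon),$$ the spherical algebras of the pointed monoids $\{0\}\cup\{\epsilon^aT^kJ_\bullet^b:a,b\in\{0,1\}\}$ with $k\ge0$, $k\le0$, $k\in\mathbf Z$ respectively. The restriction maps $\rho_\pm$ to $\mathcal O(\Omega)$ are the inclusions on powers of $T$, with $J_+\mapsto J$ and $J_-\mapsto\epsilon J$. **Points.** $\mathcal X(\mathbf C)$ is obtained by gluing $\mathrm{Hom}_{\mathbf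 F_{1^2}}(\mathcal O(\Omega_+),H\mathbf C)$ and $\mathrm{Hom}_{\mathbf F_{1^2}}(\mathcal O(\Omega_-),H\mathbf C)$ along $\mathrm{Hom}_{\mathbf F_{1^2}}(\mathcal O(\Omega),H\mathbf C)$ via $\phi\mapsto\phi\circ\rho_\pm$. **The involution $\alpha$.** It exchanges $+$ and $-$, fixes $\eta$, and acts on the sheaf by $\alpha^*(T)=\epsilon T^{-1}$, $\alpha^*(J)=\epsilon J$ on $\mathcal O(\Omega)$; $\alpha_+^*:\mathcal O(\Omega_-)\to\mathcal O(\Omega_+)$, $T^{-1}\mapsto\epsilon T$, $J_-\mapsto J_+$; $\alpha_-^*:\mathcal O(\Omega_+)\to\mathcal O(\Omega_-)$, $T\mapsto\epsilon T^{-1}$, $J_+\mapsto J_-$. It acts on points by $\alpha\cdot\phi=\phi\circ\alpha^*$ (with the appropriate version of $\alpha^*$). **Frobenius.** For $n$ odd, $\mathrm{Fr}_n(x)=x^n$ on the underlying monoids is an endomorphism of the sheaf of $\mathbf F_{1^2}$-algebras $\mathcal O$ (it fixes $\epsilon$); it acts on points by $\phi\mapsto\phi\circ\mathrm{Fr}_n$, and this induces its action on the set $\mathscr C_\infty(\mathbf C)$ of $\alpha$-orbits. **The canonical bijection** $\mathbb P^1(\mathbf C)\to\mathscr C_\infty(\mathbf C)$ sends $z\in\mathbf C$ to the $\alpha$-orbit of the point of $\Omega_+$ with $T\mapsto z$, $J_+\mapsto i$, and $\infty$ to the $\alpha$-orbit of the point of $\Omega_-$ with $T^{-1}\mapsto0$,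 $J_-\mapsto-i$. The formulas are extended to $0,\infty\in\mathbb P^1(\mathbf C)$ in the usual way ($1/0=\infty$, $1/\infty=0$, $\infty^n=\infty$). *)

theory Defs
  imports Complex_Main "HOL-Library.FuncSet" "HOL-Library.Z2" "HOL-Algebra.Group"
begin

section \<open>Pointed monoids over \<open>{0, 1, \<epsilon>}\<close>\<close>

text \<open>A record \<open>M\<close> of the type below stands for the spherical algebra \<open>F\<^sub>1[M]\<close>, together with the
  structure of an algebra over \<open>F\<^sub>1[{0, 1, \<epsilon>}]\<close> given by the choice of the image of \<open>\<epsilon>\<close>.\<close>

record 'a eps_monoid = "'a monoid" +
  pt :: 'a
  eps :: 'a

definition eps_pointed_monoid :: "'a eps_monoid \<Rightarrow> bool" where
  "eps_pointed_monoid M \<longleftrightarrow> comm_monoid M \<and>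
     pt M \<in> carrier M \<and> (\<forall>x\<in>carrier M. pt M \<otimes>\<^bsub>M\<^esub> x = pt M) \<and>
     eps M \<in> carrier M \<and> eps M \<otimes>\<^bsub>M\<^esub> eps M = \<one>\<^bsub>M\<^esub>"

text \<open>Homomorphisms are extensional functions, so that equality of homomorphisms is equality of
  functions.\<close>

definition eps_hom :: "'a eps_monoid \<Rightarrow> 'b eps_monoid \<Rightarrow> ('a \<Rightarrow> 'b) set" where
  "eps_hom M N = {f \<in> hom M N \<inter> extensional (carrier M).
     f (pt M) = pt N \<and> f \<one>\<^bsub>M\<^esub> = \<one>\<^bsub>N\<^esub> \<and> f (eps M) = eps N}"

text \<open>Homomorphisms \<open>F\<^sub>1[M] \<rightarrow> HR\<close> are the multiplicative maps \<open>M \<rightarrow> R\<close> preserving 0 and 1, so only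
  the multiplicative monoid of \<open>R\<close>, with \<open>\<epsilon> = -1\<close>, is recorded.\<close>

definition HR :: "('r::comm_ring_1) eps_monoid" where
  "HR = \<lparr>carrier = UNIV, mult = (*), one = 1, pt = 0, eps = - 1\<rparr>"

section \<open>The space and its structure sheaf\<close>

datatype pnt = Plus | Minus | Eta

text \<open>Every point \<open>x\<close> has a smallest open neighbourhood, namely \<open>\<Omega>\<^sub>+\<close>, \<open>\<Omega>\<^sub>-\<close>, \<open>\<Omega>\<close> for \<open>x = +, -, \<eta>\<close>.
  Sections over it are indexed by \<open>x\<close>; these values together with the restriction maps to
  \<open>\<Omega>\<close> determine the sheaf.

  \<open>Mon a k b\<close> is \<open>\<epsilon>\<^sup>a T\<^sup>k J\<^sup>b\<close>, where \<open>J\<close> is read as \<open>J\<^sub>+\<close>, \<open>J\<^sub>-\<close> or \<open>J\<close> according to the open set.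
  The exponents \<open>a, b\<close> are taken modulo 2, and the summand \<open>b * b'\<close> in the product is the carry
  from \<open>J\<^sup>2 = \<epsilon>\<close>.\<close>

datatype elt = Zero | Mon bit int bit

fun elt_mult :: "elt \<Rightarrow> elt \<Rightarrow> elt" where
  "elt_mult (Mon a k b) (Mon a' k' b') = Mon (a + a' + b * b') (k + k') (b + b')"
| "elt_mult _ _ = Zero"

fun T_exponents :: "pnt \<Rightarrow> int set" where
  "T_exponents Plus = {0..}"
| "T_exponents Minus = {..0}"
| "T_exponents Eta = UNIV"

definition sheaf :: "pnt \<Rightarrow> elt eps_monoid" where
  "sheaf x = \<lparr>carrier = insert Zero {Mon a k b | a k b. k \<in> T_exponents x},
     mult = elt_mult, one = Mon 0 0 0, pt = Zero, eps = Mon 1 0 0\<rparr>"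

abbreviation T_pow :: "int \<Rightarrow> elt" where
  "T_pow k \<equiv> Mon 0 k 0"

abbreviation J :: elt where
  "J \<equiv> Mon 0 0 1"

text \<open>The restriction from the smallest neighbourhood of \<open>x\<close> to \<open>\<Omega>\<close>; since \<open>J\<^sub>- \<mapsto> \<epsilon>J\<close>, the element
  \<open>\<epsilon>\<^sup>a T\<^sup>k J\<^sub>-\<^sup>b\<close> goes to \<open>\<epsilon>\<^sup>a\<^sup>+\<^sup>b T\<^sup>k J\<^sup>b\<close>.\<close>

fun rho :: "pnt \<Rightarrow> elt \<Rightarrow> elt" where
  "rho Minus (Mon a k b) = Mon (a + b) k b"
| "rho _ u = u"

text \<open>An endomorphism of the sheaf of algebras covering the identity of the space.\<close>

definition sheaf_endo :: "(pnt \<Rightarrow> elt \<Rightarrow> elt) \<Rightarrow> bool" where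
  "sheaf_endo F \<longleftrightarrow> (\<forall>x. F x \<in> eps_hom (sheaf x) (sheaf x)) \<and>
     (\<forall>x. \<forall>u\<in>carrier (sheaf x). rho x (F x u) = F Eta (rho x u))"

definition Fr :: "nat \<Rightarrow> pnt \<Rightarrow> elt \<Rightarrow> elt" where
  "Fr n x = (\<lambda>u\<in>carrier (sheaf x). u [^]\<^bsub>sheaf x\<^esub> n)"

fun alpha :: "pnt \<Rightarrow> pnt" where
  "alpha Plus = Minus"
| "alpha Minus = Plus"
| "alpha Eta = Eta"

text \<open>\<open>alpha_star x\<close> maps sections over the smallest neighbourhood of \<open>alpha x\<close> to sections over that
  of \<open>x\<close>. The powers of \<open>\<epsilon>\<close> come from \<open>(\<epsilon>T\<^sup>-\<^sup>1)\<^sup>k = \<epsilon>\<^sup>k T\<^sup>-\<^sup>k\<close> and, over \<open>\<Omega>\<close>, \<open>(\<epsilon>J)\<^sup>b = \<epsilon>\<^sup>b J\<^sup>b\<close>.\<close>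

fun alpha_star :: "pnt \<Rightarrow> elt \<Rightarrow> elt" where
  "alpha_star Eta (Mon a k b) = Mon (a + of_int k + b) (- k) b"
| "alpha_star _ (Mon a k b) = Mon (a + of_int k) (- k) b"
| "alpha_star _ Zero = Zero"

subsection \<open>Consistency of the explicit formulas\<close>

lemma bit_add_cancel_left: "c + (c + a) = (a :: bit)"
  by (cases c; cases a) simp_all

lemma elt_mult_assoc: "elt_mult (elt_mult u v) w = elt_mult u (elt_mult v w)"
proof (cases "Zero \<in> {u, v, w}")
  case False
  then obtain a k b a' k' b' a'' k'' b''
    where uvw: "u = Mon a k b" "v = Mon a' k' b'" "w = Mon a'' k'' b''"
    by (cases u; cases v; cases w) auto
  show ?thesis
    unfolding uvw elt_mult.simps elt.inject
    by (cases b; cases b'; cases b''; cases a; cases a'; cases a'') simp_all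
qed (cases u; cases v; cases w; auto)

lemma eps_pointed_monoid_sheaf: "eps_pointed_monoid (sheaf x)"
proof -
  have "comm_monoid (sheaf x)"
  proof (rule comm_monoidI)
    fix u v w
    assume "u \<in> carrier (sheaf x)" "v \<in> carrier (sheaf x)" "w \<in> carrier (sheaf x)"
    show "u \<otimes>\<^bsub>sheaf x\<^esub> v \<otimes>\<^bsub>sheaf x\<^esub> w = u \<otimes>\<^bsub>sheaf x\<^esub> (v \<otimes>\<^bsub>sheaf x\<^esub> w)"
      by (simp add: sheaf_def elt_mult_assoc)
  next
    fix u v
    assume "u \<in> carrier (sheaf x)" "v \<in> carrier (sheaf x)"
    then show "u \<otimes>\<^bsub>sheaf x\<^esub> v \<in> carrier (sheaf x)"
      by (cases x) (auto simp: sheaf_def)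
    show "u \<otimes>\<^bsub>sheaf x\<^esub> v = v \<otimes>\<^bsub>sheaf x\<^esub> u"
      by (cases u; cases v)
        (simp_all add: sheaf_def ac_simps del: add_bit_eq_xor mult_bit_eq_and)
  next
    fix u
    show "\<one>\<^bsub>sheaf x\<^esub> \<otimes>\<^bsub>sheaf x\<^esub> u = u"
      by (cases u) (simp_all add: sheaf_def)
  qed (cases x; simp add: sheaf_def)
  then show ?thesis
    by (cases x) (auto simp: eps_pointed_monoid_def sheaf_def)
qed

lemma rho_hom: "restrict (rho x) (carrier (sheaf x)) \<in> eps_hom (sheaf x) (sheaf Eta)"
  by (cases x) (auto simp: eps_hom_def hom_def sheaf_def algebra_simps add_nonpos_nonpos)

lemma alpha_star_hom:
  "restrict (alpha_star x) (carrier (sheaf (alpha x))) \<in> eps_hom (sheaf (alpha x)) (sheaf x)"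
  by (cases x) (auto simp: eps_hom_def hom_def sheaf_def algebra_simps add_nonpos_nonpos)

lemma rho_alpha_star: "rho x (alpha_star x u) = alpha_star Eta (rho (alpha x) u)"
  by (cases x; cases u)
    (simp_all add: ac_simps bit_add_cancel_left del: add_bit_eq_xor)

lemma alpha_star_involution: "alpha_star x (alpha_star (alpha x) u) = u"
  by (cases x; cases u)
    (simp_all add: ac_simps bit_add_cancel_left del: add_bit_eq_xor)

section \<open>Complex points\<close>

type_synonym chart_point = "pnt \<times> (elt \<Rightarrow> complex)"

definition chart_points :: "chart_point set" where
  "chart_points = (SIGMA x:{Plus, Minus}. eps_hom (sheaf x) HR)"

definition glue :: "chart_point rel" where
  "glue = {((Plus, compose (carrier (sheaf Plus)) \<phi> (rho Plus)),
            (Minus, compose (carrier (sheaf Minus)) \<phi> (rho Minus))) | \<phi>.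
           \<phi> \<in> eps_hom (sheaf Eta) HR}"

definition glue_equiv :: "chart_point rel" where
  "glue_equiv = (glue \<union> glue\<inverse>)\<^sup>*"

definition X_points :: "chart_point set set" where
  "X_points = chart_points // glue_equiv"

definition glue_lift :: "(chart_point \<Rightarrow> chart_point) \<Rightarrow> chart_point set \<Rightarrow> chart_point set" where
  "glue_lift f P = (\<Union>p\<in>P. glue_equiv `` {f p})"

definition alpha_X :: "chart_point set \<Rightarrow> chart_point set" where
  "alpha_X = glue_lift
     (\<lambda>(x, \<phi>). (alpha x, compose (carrier (sheaf (alpha x))) \<phi> (alpha_star x)))"

definition Fr_X :: "nat \<Rightarrow> chart_point set \<Rightarrow> chart_point set" where
  "Fr_X n = glue_lift (\<lambda>(x, \<phi>). (x, compose (carrier (sheaf x)) \<phi> (Fr n x)))"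

text \<open>As \<open>alpha_X\<close> has order 2 on \<open>X_points\<close>, its non-negative powers exhaust the group it generates.\<close>

definition orbit :: "chart_point set \<Rightarrow> chart_point set set" where
  "orbit P = {(alpha_X ^^ k) P | k. True}"

definition C_inf :: "chart_point set set set" where
  "C_inf = orbit ` X_points"

definition Fr_C :: "nat \<Rightarrow> chart_point set set \<Rightarrow> chart_point set set" where
  "Fr_C n Q = (\<Union>P\<in>Q. orbit (Fr_X n P))"

section \<open>The projective line\<close>

datatype P1 = Fin complex | Infty

fun P1_neg :: "P1 \<Rightarrow> P1" where
  "P1_neg (Fin z) = Fin (- z)"
| "P1_neg Infty = Infty"

fun P1_inv :: "P1 \<Rightarrow> P1" where
  "P1_inv (Fin z) = (if z = 0 then Infty else Fin (1 / z))"
| "P1_inv Infty = Fin 0"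

text \<open>Only used for \<open>n > 0\<close>.\<close>

fun P1_pow :: "P1 \<Rightarrow> nat \<Rightarrow> P1" where
  "P1_pow (Fin z) n = Fin (z ^ n)"
| "P1_pow Infty n = Infty"

fun P1_cnj :: "P1 \<Rightarrow> P1" where
  "P1_cnj (Fin z) = Fin (cnj z)"
| "P1_cnj Infty = Infty"

definition sigma :: "P1 \<Rightarrow> P1" where
  "sigma z = P1_neg (P1_inv (P1_cnj z))"

fun canon :: "P1 \<Rightarrow> chart_point set set" where
  "canon (Fin z) = orbit (glue_equiv ``
     {(Plus, THE \<phi>. \<phi> \<in> eps_hom (sheaf Plus) HR \<and> \<phi> (T_pow 1) = z \<and> \<phi> J = \<i>)})"
| "canon Infty = orbit (glue_equiv ``
     {(Minus, THE \<phi>. \<phi> \<in> eps_hom (sheaf Minus) HR \<and> \<phi> (T_pow (- 1)) = 0 \<and> \<phi> J = - \<i>)})"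

text \<open>The real structure transported to the set of orbits along the canonical bijection.\<close>

definition sigma_C :: "chart_point set set \<Rightarrow> chart_point set set" where
  "sigma_C Q = canon (sigma (inv_into UNIV canon Q))"

section \<open>The odd arithmetic monoid\<close>

definition N_odd :: "nat monoid" where
  "N_odd = \<lparr>carrier = {n. odd n}, mult = (*), one = 1\<rparr>"

definition monoid_action :: "'m monoid \<Rightarrow> 's set \<Rightarrow> ('m \<Rightarrow> 's \<Rightarrow> 's) \<Rightarrow> bool" where
  "monoid_action M S act \<longleftrightarrow>
     (\<forall>m\<in>carrier M. \<forall>s\<in>S. act m s \<in> S) \<and>
     (\<forall>s\<in>S. act \<one>\<^bsub>M\<^esub> s = s) \<and>
     (\<forall>m\<in>carrier M. \<forall>n\<in>carrier M. \<forall>s\<in>S. act (m \<otimes>\<^bsub>M\<^esub> n) s = act m (act n s))"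

end

theory Submission
  imports Defs
begin

text \<open>A complex point of \<open>\<Omega>\<^sub>+\<close> or \<open>\<Omega>\<^sub>-\<close> is determined by the images of \<open>T\<^sup>\<plusminus>\<^sup>1\<close> and \<open>J\<^sub>\<plusminus>\<close>, the latter
  being a square root of -1. As \<open>J\<^sub>-\<close> restricts to \<open>\<epsilon>J\<close>, gluing yields one projective line for each
  root \<open>j\<close>, so that points have coordinates \<open>(j, P)\<close>. In these, \<open>\<alpha>\<close> is \<open>(j, P) \<mapsto> (-j, -1/P)\<close> and
  the Frobenius is \<open>(j, P) \<mapsto> (j\<^sup>n, P\<^sup>n)\<close>. Orbits are represented by the points with \<open>j = \<i>\<close>; for
  \<open>n \<equiv> 3\<close> modulo 4 the Frobenius exchanges the two lines, and \<open>\<alpha>\<close> is needed to return to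
  \<open>j = \<i>\<close>.\<close>

section \<open>Homomorphisms of pointed monoids\<close>

lemma eps_hom_compose:
  assumes "f \<in> eps_hom M N" "g \<in> eps_hom N K" "comm_monoid M" "pt M \<in> carrier M" "eps M \<in> carrier M"
  shows "compose (carrier M) g f \<in> eps_hom M K"
  using assms unfolding eps_hom_def
  by (auto simp: compose_eq hom_def Pi_iff comm_monoid_def monoid.m_closed monoid.one_closed)

lemma compose_restrict_right: "compose A g (restrict f A) = compose A g f"
  by (auto simp: compose_def)

lemma comm_monoid_sheaf: "comm_monoid (sheaf x)"
  and pt_sheaf_closed: "pt (sheaf x) \<in> carrier (sheaf x)"
  and eps_sheaf_closed: "eps (sheaf x) \<in> carrier (sheaf x)"
  using eps_pointed_monoid_sheaf[of x] by (auto simp: eps_pointed_monoid_def)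

lemma monoid_sheaf: "monoid (sheaf x)"
  using comm_monoid_sheaf comm_monoid.axioms(1) by blast

lemmas sheaf_compose = eps_hom_compose[OF _ _ comm_monoid_sheaf pt_sheaf_closed eps_sheaf_closed]

lemma sheaf_simps:
  "Zero \<in> carrier (sheaf x)"
  "Mon a k b \<in> carrier (sheaf x) \<longleftrightarrow> k \<in> T_exponents x"
  "mult (sheaf x) = elt_mult" "one (sheaf x) = Mon 0 0 0"
  "pt (sheaf x) = Zero" "eps (sheaf x) = Mon 1 0 0"
  by (auto simp: sheaf_def)

lemma zero_in_T_exponents [simp]: "0 \<in> T_exponents x"
  by (cases x) auto

lemma HR_simps [simp]:
  "carrier HR = UNIV" "mult HR = (*)" "one HR = 1" "pt HR = 0" "eps HR = - 1"
  by (simp_all add: HR_def)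

section \<open>Values of homomorphisms on monomials\<close>

lemma sheaf_hom_mult:
  assumes "\<phi> \<in> eps_hom (sheaf x) HR" "u \<in> carrier (sheaf x)" "v \<in> carrier (sheaf x)"
  shows "\<phi> (elt_mult u v) = \<phi> u * \<phi> v"
  using assms by (auto simp: eps_hom_def hom_def sheaf_simps)

lemma sheaf_hom_simps:
  assumes "\<phi> \<in> eps_hom (sheaf x) HR"
  shows "\<phi> Zero = 0" "\<phi> (Mon 0 0 0) = 1" "\<phi> (Mon 1 0 0) = - 1"
  using assms by (auto simp: eps_hom_def sheaf_simps)

lemma sheaf_hom_J:
  assumes "\<phi> \<in> eps_hom (sheaf x) HR"
  shows "\<phi> J * \<phi> J = - 1"
  using sheaf_hom_mult[OF assms, of J J] sheaf_hom_simps[OF assms] by (simp add: sheaf_simps)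

lemma sheaf_hom_Mon:
  assumes "\<phi> \<in> eps_hom (sheaf x) HR" "k \<in> T_exponents x"
  shows "\<phi> (Mon a k b) = (if a = 0 then 1 else - 1) * \<phi> (T_pow k) * (if b = 0 then 1 else \<phi> J)"
proof -
  note \<phi> = assms(1)
  have "\<phi> (Mon a k b) = \<phi> (Mon a 0 0) * \<phi> (T_pow k) * \<phi> (Mon 0 0 b)"
    using sheaf_hom_mult[OF \<phi>, of "Mon a k 0" "Mon 0 0 b"]
      sheaf_hom_mult[OF \<phi>, of "Mon a 0 0" "T_pow k"] assms(2)
    by (cases a; cases b) (simp_all add: sheaf_simps)
  then show ?thesis
    using sheaf_hom_simps[OF \<phi>] by (cases a; cases b) simp_all
qed

text \<open>Taking \<open>s\<close> as 1 or -1 covers both charts at once; the hypothesis on all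
  \<open>m\<close> keeps the induction inside the admissible exponents.\<close>

lemma sheaf_hom_T_pow:
  assumes "\<phi> \<in> eps_hom (sheaf x) HR" "\<And>m. int m * s \<in> T_exponents x"
  shows "\<phi> (T_pow (int m * s)) = \<phi> (T_pow s) ^ m"
proof (induction m)
  case 0
  show ?case using sheaf_hom_simps[OF assms(1)] by simp
next
  case (Suc m)
  have "s \<in> T_exponents x" using assms(2)[of 1] by simp
  then show ?case
    using sheaf_hom_mult[OF assms(1), of "T_pow s" "T_pow (int m * s)"] assms(2)[of m] Suc
    by (simp add: sheaf_simps algebra_simps)
qed

text \<open>The exponent of the power of \<open>T\<close> that generates a chart; at
  \<open>Eta\<close> the value 1 makes the parameter \<open>c\<close> of \<open>ev\<close> the image
  of \<open>T\<close>.\<close>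

fun T_sign :: "pnt \<Rightarrow> int" where
  "T_sign Minus = - 1"
| "T_sign _ = 1"

lemma sheaf_hom_eqI:
  assumes "\<phi> \<in> eps_hom (sheaf x) HR" "\<psi> \<in> eps_hom (sheaf x) HR" "x \<noteq> Eta"
    and T: "\<phi> (T_pow (T_sign x)) = \<psi> (T_pow (T_sign x))" and J: "\<phi> J = \<psi> J"
  shows "\<phi> = \<psi>"
proof (rule extensionalityI[of _ "carrier (sheaf x)"])
  fix u assume u: "u \<in> carrier (sheaf x)"
  have e: "int m * T_sign x \<in> T_exponents x" for m
    using assms(3) by (cases x) auto
  show "\<phi> u = \<psi> u"
  proof (cases u)
    case Zero
    then show ?thesis using sheaf_hom_simps(1)[OF assms(1)] sheaf_hom_simps(1)[OF assms(2)] by simp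
  next
    case (Mon a k b)
    with u have k: "k \<in> T_exponents x" by (simp add: sheaf_simps)
    \<comment> \<open>On a chart every exponent is a nonnegative multiple of
      \<open>T_sign x\<close>, so natural powers of one generator suffice.\<close>
    then obtain m where "k = int m * T_sign x"
      using assms(3) that[of "nat \<bar>k\<bar>"] by (cases x) auto
    then have "\<phi> (T_pow k) = \<psi> (T_pow k)"
      using sheaf_hom_T_pow[OF assms(1) e, of m] sheaf_hom_T_pow[OF assms(2) e, of m] T by simp
    then show ?thesis
      using sheaf_hom_Mon[OF assms(1) k, of a b] sheaf_hom_Mon[OF assms(2) k, of a b] J Mon
      by (simp only:)
  qed
qed (use assms in \<open>auto simp: eps_hom_def\<close>)

text \<open>With \<open>powi\<close> one formula serves all three opens; on a chart the exponent is
  nonnegative, so \<open>c = 0\<close> is allowed, with value 1 at exponent 0.\<close>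

definition ev :: "pnt \<Rightarrow> complex \<Rightarrow> complex \<Rightarrow> elt \<Rightarrow> complex" where
  "ev x c j = (\<lambda>u\<in>carrier (sheaf x). case u of Zero \<Rightarrow> 0
     | Mon a k b \<Rightarrow> (if a = 0 then 1 else - 1) * c powi (k * T_sign x) * (if b = 0 then 1 else j))"

text \<open>The condition on \<open>j\<close> respects the relation \<open>J^2 = eps\<close>; over
  \<open>Eta\<close> the element \<open>T\<close> is invertible, hence so must be
  \<open>c\<close>.\<close>

lemma ev_hom:
  assumes "j * j = - 1" "x = Eta \<Longrightarrow> c \<noteq> 0"
  shows "ev x c j \<in> eps_hom (sheaf x) HR"
proof -
  \<comment> \<open>The exponent law can fail only for zero \<open>c\<close> and exponents of mixed
    sign: over \<open>Eta\<close> the base is nonzero, on a chart both exponents are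
    nonnegative.\<close>
  have add: "c powi ((k + l) * T_sign x) = c powi (k * T_sign x) * c powi (l * T_sign x)"
    if "k \<in> T_exponents x" "l \<in> T_exponents x" for k l
  proof (cases "x = Eta")
    case True
    then show ?thesis using assms(2) by (simp add: power_int_add)
  next
    case False
    with that have "0 \<le> k * T_sign x" "0 \<le> l * T_sign x" by (cases x; simp)+
    then show ?thesis
      by (simp add: power_int_def nat_add_distrib power_add distrib_right)
  qed
  have closed: "elt_mult u v \<in> carrier (sheaf x)"
    if "u \<in> carrier (sheaf x)" "v \<in> carrier (sheaf x)" for u v
    using monoid.m_closed[OF monoid_sheaf that]
    by (simp add: sheaf_simps)
  have "ev x c j (elt_mult u v) = ev x c j u * ev x c j v"
    if "u \<in> carrier (sheaf x)" "v \<in> carrier (sheaf x)" for u v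
  proof (cases "Zero \<in> {u, v}")
    case True
    then show ?thesis by (cases u; cases v) (auto simp: ev_def sheaf_simps)
  next
    case False
    then obtain a k b a' k' b' where uv: "u = Mon a k b" "v = Mon a' k' b'"
      by (cases u; cases v) auto
    \<comment> \<open>This matches the carry in \<open>elt_mult\<close>, where two factors
      \<open>J\<close> multiply to \<open>eps\<close>.\<close>
    have "x * j * (y * j) = x * y * (j * j)" for x y
      by (simp add: ac_simps)
    then have "x * j * (y * j) = - (x * y)" for x y
      using assms(1) by simp
    then show ?thesis
      using that closed[OF that] add[of k k'] unfolding uv
      by (cases a; cases b; cases a'; cases b') (auto simp: ev_def sheaf_simps)
  qed
  then show ?thesis
    by (auto simp: eps_hom_def hom_def sheaf_simps) (auto simp: ev_def sheaf_simps)
qed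

lemma ev_T_pow: "T_sign x \<in> T_exponents x \<Longrightarrow> ev x c j (T_pow (T_sign x)) = c"
  by (cases x) (auto simp: ev_def sheaf_simps)

lemma ev_J: "ev x c j J = j"
  by (auto simp: ev_def sheaf_simps)

section \<open>Coordinates on the complex points\<close>

abbreviation (input) antip :: "P1 \<Rightarrow> P1" where
  "antip P \<equiv> P1_neg (P1_inv P)"

lemma P1_inv_inv [simp]: "P1_inv (P1_inv P) = P"
  by (cases P) auto

lemma antip_antip [simp]: "antip (antip P) = P"
  by (cases P) auto

lemma P1_pow_inv: "n > 0 \<Longrightarrow> P1_pow (P1_inv P) n = P1_inv (P1_pow P n)"
  by (cases P) (auto simp: power_one_over)

lemma P1_pow_neg: "odd n \<Longrightarrow> P1_pow (P1_neg P) n = P1_neg (P1_pow P n)"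
  by (cases P) auto

text \<open>An odd power fixes -1 and commutes with inversion. This underlies the compatibility of
  Frobenius with both \<open>alpha\<close> and \<open>sigma\<close>.\<close>

lemma P1_pow_antip: "odd n \<Longrightarrow> P1_pow (antip P) n = antip (P1_pow P n)"
  by (simp add: P1_pow_inv P1_pow_neg odd_pos)

lemma P1_pow_cnj: "P1_pow (P1_cnj P) n = P1_cnj (P1_pow P n)"
  by (cases P) auto

lemma antip_cnj: "antip (P1_cnj P) = P1_cnj (antip P)"
  by (cases P) auto

lemma P1_pow_mult: "P1_pow P (m * n) = P1_pow (P1_pow P n) m"
  by (cases P) (auto simp: mult.commute simp flip: power_mult)

lemma P1_pow_1: "P1_pow P (Suc 0) = P"
  by (cases P) auto

text \<open>On \<open>Minus\<close> the sign undoes the \<open>eps\<close> in the restriction of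
  \<open>J\<close>, and the inverse passes from \<open>T^-1\<close> to \<open>T\<close>; so both
  charts read off the values of \<open>J\<close> and \<open>T\<close> on the overlap.\<close>

fun coord :: "chart_point \<Rightarrow> complex \<times> P1" where
  "coord (Minus, \<phi>) = (- \<phi> J, P1_inv (Fin (\<phi> (T_pow (- 1)))))"
| "coord (_, \<phi>) = (\<phi> J, Fin (\<phi> (T_pow 1)))"

definition cls :: "complex \<Rightarrow> P1 \<Rightarrow> chart_point set" where
  "cls j P = {p \<in> chart_points. coord p = (j, P)}"

lemma coord_glue:
  assumes "(p, q) \<in> glue"
  shows "p \<in> chart_points \<and> q \<in> chart_points \<and> coord p = coord q"
proof -
  obtain \<phi> where \<phi>: "\<phi> \<in> eps_hom (sheaf Eta) HR"
    and p: "p = (Plus, compose (carrier (sheaf Plus)) \<phi> (rho Plus))"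
    and q: "q = (Minus, compose (carrier (sheaf Minus)) \<phi> (rho Minus))"
    using assms by (auto simp: glue_def)
  have chart: "compose (carrier (sheaf x)) \<phi> (rho x) \<in> eps_hom (sheaf x) HR" for x
    using sheaf_compose[OF rho_hom \<phi>] by (simp add: compose_restrict_right)
  have T: "\<phi> (T_pow 1) * \<phi> (T_pow (- 1)) = 1"
    using sheaf_hom_mult[OF \<phi>, of "T_pow 1" "T_pow (- 1)"] sheaf_hom_simps[OF \<phi>]
    by (simp add: sheaf_simps)
  then have "\<phi> (T_pow (- 1)) \<noteq> 0" "\<phi> (T_pow 1) = 1 / \<phi> (T_pow (- 1))"
    by (auto intro: eq_divide_imp)
  \<comment> \<open>\<open>Mon 1 0 1\<close> is the restriction of \<open>J\<close> from
    \<open>Minus\<close>.\<close>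
  moreover have "\<phi> (Mon 1 0 1) = - \<phi> J"
    using sheaf_hom_Mon[OF \<phi>, of 0 1 1] sheaf_hom_simps[OF \<phi>] by simp
  ultimately show ?thesis
    using chart by (auto simp: p q chart_points_def compose_eq sheaf_simps)
qed

lemma coord_glue_equiv:
  assumes "(p, q) \<in> glue_equiv" "p \<in> chart_points"
  shows "q \<in> chart_points \<and> coord q = coord p"
  using assms unfolding glue_equiv_def
  by (induction rule: rtrancl_induct) (auto dest: coord_glue)

text \<open>A \<open>Plus\<close> point has a finite coordinate, so a \<open>Minus\<close> point
  sharing it sends \<open>T^-1\<close> to a nonzero number; then both extend to the overlap.\<close>

lemma glue_of_coord_eq:
  assumes \<phi>: "\<phi> \<in> eps_hom (sheaf Plus) HR" and \<psi>: "\<psi> \<in> eps_hom (sheaf Minus) HR"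
    and eq: "coord (Plus, \<phi>) = coord (Minus, \<psi>)"
  shows "((Plus, \<phi>), (Minus, \<psi>)) \<in> glue"
proof -
  define \<theta> where "\<theta> = ev Eta (\<phi> (T_pow 1)) (\<phi> J)"
  have c: "\<phi> (T_pow 1) \<noteq> 0" "\<psi> (T_pow (- 1)) = inverse (\<phi> (T_pow 1))" "\<psi> J = - \<phi> J"
    using eq by (auto split: if_splits)
  have \<theta>: "\<theta> \<in> eps_hom (sheaf Eta) HR"
    unfolding \<theta>_def using c(1) sheaf_hom_J[OF \<phi>] by (intro ev_hom) auto
  have chart: "compose (carrier (sheaf x)) \<theta> (rho x) \<in> eps_hom (sheaf x) HR" for x
    using sheaf_compose[OF rho_hom \<theta>] by (simp add: compose_restrict_right)
  have "\<phi> = compose (carrier (sheaf Plus)) \<theta> (rho Plus)"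
    using \<phi> chart by (rule sheaf_hom_eqI) (auto simp: compose_eq sheaf_simps \<theta>_def ev_def)
  moreover have "\<psi> = compose (carrier (sheaf Minus)) \<theta> (rho Minus)"
    using \<psi> chart
    by (rule sheaf_hom_eqI) (auto simp: compose_eq sheaf_simps \<theta>_def ev_def c power_int_minus)
  ultimately show ?thesis using \<theta> unfolding glue_def by blast
qed

lemma glue_equiv_of_coord_eq:
  assumes "p \<in> chart_points" "q \<in> chart_points" "coord p = coord q"
  shows "(p, q) \<in> glue_equiv"
proof -
  obtain x \<phi> y \<psi> where pq: "p = (x, \<phi>)" "q = (y, \<psi>)" by (metis surj_pair)
  have \<phi>: "\<phi> \<in> eps_hom (sheaf x) HR" and \<psi>: "\<psi> \<in> eps_hom (sheaf y) HR"
    and "x \<noteq> Eta" "y \<noteq> Eta"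
    using assms pq by (auto simp: chart_points_def)
  then consider "x = Plus" "y = Minus" | "x = Minus" "y = Plus" | "x = y"
    by (cases x; cases y) auto
  then show ?thesis
  proof cases
    case 1
    then show ?thesis using glue_of_coord_eq \<phi> \<psi> assms(3) pq by (auto simp: glue_equiv_def)
  next
    case 2
    then have "(q, p) \<in> glue" using glue_of_coord_eq \<phi> \<psi> assms(3) pq by auto
    then show ?thesis by (auto simp: glue_equiv_def)
  next
    case 3
    have "\<phi> J = \<psi> J" "\<phi> (T_pow (T_sign x)) = \<psi> (T_pow (T_sign x))"
      using assms(3) 3 \<open>x \<noteq> Eta\<close> unfolding pq by (cases x; simp split: if_splits)+
    then have "\<phi> = \<psi>" using sheaf_hom_eqI[of \<phi> x \<psi>] \<phi> \<psi> 3 \<open>x \<noteq> Eta\<close> by auto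
    then show ?thesis using pq 3 by (auto simp: glue_equiv_def)
  qed
qed

lemma glue_class:
  assumes "p \<in> chart_points" "coord p = (j, P)"
  shows "glue_equiv `` {p} = cls j P"
  using assms by (auto simp: cls_def dest: coord_glue_equiv intro: glue_equiv_of_coord_eq)

lemma cls_nonempty:
  assumes "j * j = - 1"
  obtains p where "p \<in> chart_points" "coord p = (j, P)"
proof (cases P)
  case (Fin z)
  have "(Plus, ev Plus z j) \<in> chart_points"
    using ev_hom[of j Plus z] assms by (auto simp: chart_points_def)
  moreover have "coord (Plus, ev Plus z j) = (j, P)"
    using ev_T_pow[of Plus z j] ev_J[of Plus] Fin by simp
  ultimately show ?thesis by (rule that)
next
  case Infty
  \<comment> \<open>Infinity lies only in the \<open>Minus\<close> chart, at
    \<open>T^-1 = 0\<close>; \<open>coord\<close> negates the value of \<open>J\<close>, whence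
    \<open>- j\<close>.\<close>
  have "(Minus, ev Minus 0 (- j)) \<in> chart_points"
    using ev_hom[of "- j" Minus 0] assms by (auto simp: chart_points_def)
  moreover have "coord (Minus, ev Minus 0 (- j)) = (j, P)"
    using ev_T_pow[of Minus 0 "- j"] ev_J[of Minus] Infty by simp
  ultimately show ?thesis by (rule that)
qed

lemma coord_root:
  assumes "p \<in> chart_points" "coord p = (j, P)"
  shows "j * j = - 1"
proof -
  obtain x \<phi> where p: "p = (x, \<phi>)" "\<phi> \<in> eps_hom (sheaf x) HR"
    using assms(1) by (auto simp: chart_points_def)
  with sheaf_hom_J[OF p(2)] assms(2) show ?thesis by (cases x) auto
qed

text \<open>Distinct fibres of \<open>coord\<close> are disjoint, and the root condition makes the
  first one nonempty.\<close>

lemma cls_inj: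
  assumes "j * j = - 1" "cls j P = cls k Q"
  shows "j = k \<and> P = Q"
proof -
  obtain p where "p \<in> chart_points" "coord p = (j, P)" using cls_nonempty[OF assms(1)] .
  then have "p \<in> cls j P" by (simp add: cls_def)
  then have "p \<in> cls k Q" using assms(2) by simp
  with \<open>coord p = (j, P)\<close> show ?thesis by (auto simp: cls_def)
qed

lemma X_points_eq: "X_points = {cls j P | j P. j * j = - 1}"
proof (intro equalityI subsetI)
  fix A assume "A \<in> X_points"
  then obtain p where p: "p \<in> chart_points" "A = glue_equiv `` {p}"
    by (auto simp: X_points_def elim: quotientE)
  obtain j P where "coord p = (j, P)" by (cases "coord p")
  then show "A \<in> {cls j P | j P. j * j = - 1}" using p glue_class coord_root by blast
next
  fix A assume "A \<in> {cls j P | j P. j * j = - 1}"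
  then obtain j P where A: "A = cls j P" "j * j = - 1" by blast
  obtain p where "p \<in> chart_points" "coord p = (j, P)" using cls_nonempty[OF A(2)] .
  then show "A \<in> X_points"
    using quotientI[of p chart_points glue_equiv] glue_class A by (simp add: X_points_def)
qed

text \<open>\<open>glue_lift\<close> is a union over representatives; it collapses to one class once
  \<open>f\<close> respects coordinates and the fibre is nonempty.\<close>

lemma glue_lift_cls:
  assumes "j * j = - 1"
    and "\<And>p. p \<in> chart_points \<Longrightarrow> coord p = (j, P) \<Longrightarrow> f p \<in> chart_points \<and> coord (f p) = (k, Q)"
  shows "glue_lift f (cls j P) = cls k Q"
proof -
  obtain p where "p \<in> chart_points" "coord p = (j, P)" using cls_nonempty[OF assms(1)] .
  then have "cls j P \<noteq> {}" by (auto simp only: cls_def)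
  moreover have "glue_equiv `` {f q} = cls k Q" if "q \<in> cls j P" for q
    using that assms(2) glue_class by (auto simp: cls_def)
  ultimately show ?thesis unfolding glue_lift_def by auto
qed

text \<open>Changing charts while keeping the value of \<open>J\<close> flips the sign of
  \<open>j\<close>, and \<open>T^-1\<close> going to \<open>eps T\<close> produces -1/P.\<close>

lemma alpha_X_cls:
  assumes "j * j = - 1"
  shows "alpha_X (cls j P) = cls (- j) (antip P)"
  unfolding alpha_X_def
proof (rule glue_lift_cls[OF assms])
  fix p assume p: "p \<in> chart_points" "coord p = (j, P)"
  obtain x \<phi> where x: "p = (x, \<phi>)" "x \<noteq> Eta" and \<phi>: "\<phi> \<in> eps_hom (sheaf x) HR"
    using p(1) by (auto simp: chart_points_def)
  have "compose (carrier (sheaf (alpha x))) \<phi> (alpha_star x) \<in> eps_hom (sheaf (alpha x)) HR"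
    using sheaf_compose[OF alpha_star_hom \<phi>] by (simp add: compose_restrict_right)
  \<comment> \<open>The argument on the left is the \<open>alpha_star\<close> image of the generator
    of the opposite chart.\<close>
  moreover have "\<phi> (Mon 1 (T_sign x) 0) = - \<phi> (T_pow (T_sign x))"
    using sheaf_hom_Mon[OF \<phi>, of "T_sign x" 1 0] x(2) by (cases x) auto
  ultimately show "(case p of (x, \<phi>) \<Rightarrow>
        (alpha x, compose (carrier (sheaf (alpha x))) \<phi> (alpha_star x))) \<in> chart_points \<and>
      coord (case p of (x, \<phi>) \<Rightarrow>
        (alpha x, compose (carrier (sheaf (alpha x))) \<phi> (alpha_star x))) = (- j, antip P)"
    using x p(2) by (cases x) (auto simp: chart_points_def compose_eq sheaf_simps)
qed

section \<open>The Frobenius endomorphisms\<close>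

lemma eps_pow_odd:
  fixes n :: nat
  assumes "eps_pointed_monoid M" "odd n"
  shows "eps M [^]\<^bsub>M\<^esub> n = eps M"
proof -
  interpret comm_monoid M using assms(1) by (simp add: eps_pointed_monoid_def)
  have e: "eps M \<in> carrier M" "eps M \<otimes>\<^bsub>M\<^esub> eps M = \<one>\<^bsub>M\<^esub>"
    using assms(1) by (simp_all add: eps_pointed_monoid_def)
  obtain k where n: "n = 2 * k + 1" using assms(2) by (elim oddE)
  have "eps M [^]\<^bsub>M\<^esub> (2::nat) = \<one>\<^bsub>M\<^esub>" using e by (simp add: numeral_2_eq_2)
  then have "eps M [^]\<^bsub>M\<^esub> (2 * k) = \<one>\<^bsub>M\<^esub>"
    using nat_pow_pow[OF e(1), of 2 k, symmetric] by simp
  then show ?thesis using e n by simp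
qed

text \<open>Commutativity makes the power map multiplicative; oddness makes it fix
  \<open>eps M\<close>.\<close>

lemma pow_eps_hom:
  fixes n :: nat
  assumes M: "eps_pointed_monoid M" and "odd n"
  shows "(\<lambda>u\<in>carrier M. u [^]\<^bsub>M\<^esub> n) \<in> eps_hom M M"
proof -
  interpret comm_monoid M using M by (simp add: eps_pointed_monoid_def)
  have p: "pt M \<in> carrier M" "\<And>x. x \<in> carrier M \<Longrightarrow> pt M \<otimes>\<^bsub>M\<^esub> x = pt M"
    "eps M \<in> carrier M"
    using M by (simp_all add: eps_pointed_monoid_def)
  \<comment> \<open>Positivity matters: the zeroth power would send \<open>pt M\<close> to the
    unit.\<close>
  obtain m where n: "n = Suc m" using assms(2) by (cases n) auto
  have "pt M [^]\<^bsub>M\<^esub> n = pt M"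
    using p m_comm[of "pt M [^]\<^bsub>M\<^esub> m" "pt M"] n by simp
  then show ?thesis
    using p eps_pow_odd[OF assms] by (auto simp: eps_hom_def hom_def nat_pow_distrib)
qed

lemma Fr_hom: "odd n \<Longrightarrow> Fr n x \<in> eps_hom (sheaf x) (sheaf x)"
  unfolding Fr_def by (rule pow_eps_hom[OF eps_pointed_monoid_sheaf])

text \<open>Applied to restriction maps this makes Frobenius a sheaf map; applied to complex points
  it gives their image under Frobenius.\<close>

lemma eps_hom_pow:
  fixes n :: nat
  assumes "\<phi> \<in> eps_hom M N" "monoid M" "monoid N" "u \<in> carrier M"
  shows "\<phi> (u [^]\<^bsub>M\<^esub> n) = \<phi> u [^]\<^bsub>N\<^esub> n"
proof -
  interpret M: monoid M by fact
  interpret N: monoid N by fact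
  show ?thesis
    using assms(1,4) by (induction n) (auto simp: eps_hom_def hom_def)
qed

lemma monoid_HR: "monoid HR"
  by (rule monoidI) (auto simp: mult.assoc)

lemma HR_pow: "(a :: 'r::comm_ring_1) [^]\<^bsub>HR\<^esub> (n::nat) = a ^ n"
proof -
  interpret monoid "HR :: 'r eps_monoid" by (rule monoid_HR)
  show ?thesis by (induction n) (auto simp: mult.commute)
qed

lemma sheaf_endo_Fr:
  assumes "odd n"
  shows "sheaf_endo (Fr n)"
  unfolding sheaf_endo_def
proof (intro conjI allI ballI)
  fix x u assume u: "u \<in> carrier (sheaf x)"
  have r: "restrict (rho x) (carrier (sheaf x)) u \<in> carrier (sheaf Eta)"
    using rho_hom[of x] u unfolding eps_hom_def hom_def by blast
  have "u [^]\<^bsub>sheaf x\<^esub> n \<in> carrier (sheaf x)"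
    using monoid.nat_pow_closed[OF monoid_sheaf u] .
  then show "rho x (Fr n x u) = Fr n Eta (rho x u)"
    using u r eps_hom_pow[OF rho_hom monoid_sheaf monoid_sheaf u, of n] by (simp add: Fr_def)
qed (rule Fr_hom[OF assms])

lemma root_power: "j * j = (- 1 :: complex) \<Longrightarrow> odd n \<Longrightarrow> j ^ n * j ^ n = - 1"
  by (simp flip: power_mult_distrib)

text \<open>Precomposing with Frobenius raises all values of a point to the power \<open>n\<close>;
  oddness preserves the sign in the \<open>Minus\<close> coordinate.\<close>

lemma Fr_X_cls:
  assumes "j * j = - 1" "odd n"
  shows "Fr_X n (cls j P) = cls (j ^ n) (P1_pow P n)"
  unfolding Fr_X_def
proof (rule glue_lift_cls[OF assms(1)])
  fix p assume p: "p \<in> chart_points" "coord p = (j, P)"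
  obtain x \<phi> where x: "p = (x, \<phi>)" "x \<noteq> Eta" and \<phi>: "\<phi> \<in> eps_hom (sheaf x) HR"
    using p(1) by (auto simp: chart_points_def)
  have "compose (carrier (sheaf x)) \<phi> (Fr n x) \<in> eps_hom (sheaf x) HR"
    using sheaf_compose[OF Fr_hom \<phi>] assms(2) by simp
  moreover have pw: "compose (carrier (sheaf x)) \<phi> (Fr n x) u = \<phi> u ^ n"
    if "u \<in> carrier (sheaf x)" for u
    using that eps_hom_pow[OF \<phi> monoid_sheaf monoid_HR that]
    by (simp add: compose_eq Fr_def HR_pow)
  ultimately show "(case p of (x, \<phi>) \<Rightarrow> (x, compose (carrier (sheaf x)) \<phi> (Fr n x)))
        \<in> chart_points \<and>
      coord (case p of (x, \<phi>) \<Rightarrow> (x, compose (carrier (sheaf x)) \<phi> (Fr n x)))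
        = (j ^ n, P1_pow P n)"
    using x p(2) assms(2) odd_pos[OF assms(2)]
    by (cases x) (auto simp: chart_points_def sheaf_simps power_one_over)
qed

section \<open>Orbits\<close>

text \<open>\<open>alpha_X\<close> squares to the identity on coordinates, so the powers 0 and 1
  give all members.\<close>

lemma orbit_cls:
  assumes "j * j = - 1"
  shows "orbit (cls j P) = {cls j P, cls (- j) (antip P)}"
proof -
  have 1: "alpha_X (cls j P) = cls (- j) (antip P)" "alpha_X (cls (- j) (antip P)) = cls j P"
    using alpha_X_cls[of j P] alpha_X_cls[of "- j" "antip P"] assms by auto
  have "(alpha_X ^^ k) (cls j P) = (if even k then cls j P else cls (- j) (antip P))" for k
    by (induction k) (auto simp: 1)
  then show ?thesis unfolding orbit_def by (auto intro: exI[of _ 0] exI[of _ 1])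
qed

text \<open>Both orbits are the same pair of classes; this allows a return from the root
  \<open>- j\<close> to \<open>j\<close>.\<close>

lemma orbit_antip:
  assumes "j * j = - 1"
  shows "orbit (cls (- j) P) = orbit (cls j (antip P))"
  using orbit_cls[of "- j" P] orbit_cls[of j "antip P"] assms by auto

section \<open>The canonical bijection\<close>

lemma the_sheaf_hom:
  assumes "x \<noteq> Eta" "j * j = - 1"
  shows "(THE \<phi>. \<phi> \<in> eps_hom (sheaf x) HR \<and> \<phi> (T_pow (T_sign x)) = c \<and> \<phi> J = j) = ev x c j"
proof (rule the_equality)
  show 1: "ev x c j \<in> eps_hom (sheaf x) HR \<and> ev x c j (T_pow (T_sign x)) = c \<and> ev x c j J = j"
    using assms by (cases x) (auto intro: ev_hom simp: ev_J ev_T_pow[of Plus, simplified]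
        ev_T_pow[of Minus, simplified])
  fix \<phi> assume "\<phi> \<in> eps_hom (sheaf x) HR \<and> \<phi> (T_pow (T_sign x)) = c \<and> \<phi> J = j"
  with 1 show "\<phi> = ev x c j"
    by (intro sheaf_hom_eqI[OF _ _ assms(1)]) simp_all
qed

text \<open>In the clause for \<open>Infty\<close> the value \<open>- \<i>\<close> of
  \<open>J\<close> becomes the root \<open>\<i>\<close> under \<open>coord\<close>, so both clauses
  use the same root.\<close>

lemma canon_eq: "canon P = orbit (cls \<i> P)"
proof (cases P)
  case (Fin z)
  have "(THE \<phi>. \<phi> \<in> eps_hom (sheaf Plus) HR \<and> \<phi> (T_pow 1) = z \<and> \<phi> J = \<i>) = ev Plus z \<i>"
    using the_sheaf_hom[of Plus \<i> z] by simp
  then show ?thesis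
    using glue_class[of "(Plus, ev Plus z \<i>)" \<i> P] ev_hom[of \<i> Plus z] ev_T_pow[of Plus z \<i>]
      ev_J[of Plus z \<i>] Fin
    by (simp add: chart_points_def)
next
  case Infty
  have "(THE \<phi>. \<phi> \<in> eps_hom (sheaf Minus) HR \<and> \<phi> (T_pow (- 1)) = 0 \<and> \<phi> J = - \<i>)
      = ev Minus 0 (- \<i>)"
    using the_sheaf_hom[of Minus "- \<i>" 0] by simp
  then show ?thesis
    using glue_class[of "(Minus, ev Minus 0 (- \<i>))" \<i> P] ev_hom[of "- \<i>" Minus 0]
      ev_T_pow[of Minus 0 "- \<i>"] ev_J[of Minus 0 "- \<i>"] Infty
    by (simp add: chart_points_def)
qed

lemma root_cases:
  assumes "j * j = (- 1 :: complex)"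
  shows "j = \<i> \<or> j = - \<i>"
proof -
  have "(j - \<i>) * (j + \<i>) = 0" using assms by (simp add: algebra_simps)
  then show ?thesis by (auto simp: add_eq_0_iff2)
qed

lemma orbit_cases:
  assumes "j * j = - 1"
  shows "orbit (cls j P) = canon (if j = \<i> then P else antip P)"
  using root_cases[OF assms] orbit_antip[of \<i> P] by (auto simp: canon_eq)

lemma C_inf_eq: "C_inf = range canon"
proof (intro equalityI subsetI)
  fix Q assume "Q \<in> C_inf"
  then show "Q \<in> range canon" using orbit_cases by (auto simp: C_inf_def X_points_eq)
next
  fix Q assume "Q \<in> range canon"
  then obtain P where "Q = orbit (cls \<i> P)" by (auto simp: canon_eq)
  then show "Q \<in> C_inf" unfolding C_inf_def X_points_eq by (intro image_eqI) auto
qed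

text \<open>An orbit has exactly one class with root \<open>\<i>\<close>; its other member has root
  \<open>- \<i>\<close>.\<close>

lemma inj_canon: "inj canon"
proof (rule injI)
  fix P Q assume "canon P = canon Q"
  then have "cls \<i> P \<in> {cls \<i> Q, cls (- \<i>) (antip Q)}"
    using orbit_cls[of \<i>] by (auto simp: canon_eq)
  then consider "cls \<i> P = cls \<i> Q" | "cls \<i> P = cls (- \<i>) (antip Q)" by blast
  then show "P = Q"
    by cases (use cls_inj[of \<i> P] in \<open>force simp: complex_eq_iff\<close>)+
qed

text \<open>Frobenius commutes with \<open>alpha_X\<close>, so both members of an orbit contribute
  the same orbit to the union. The root is general because one Frobenius may lead to
  \<open>- \<i>\<close> before the next is applied.\<close>

lemma Fr_C_orbit:
  assumes "j * j = - 1" "odd n"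
  shows "Fr_C n (orbit (cls j P)) = orbit (cls (j ^ n) (P1_pow P n))"
proof -
  have "orbit (Fr_X n (cls (- j) (antip P))) = orbit (cls (- (j ^ n)) (antip (P1_pow P n)))"
    using assms Fr_X_cls[of "- j" n "antip P"] by (simp add: P1_pow_antip)
  also have "\<dots> = orbit (cls (j ^ n) (P1_pow P n))"
    using orbit_antip[OF root_power[OF assms]] by simp
  finally show ?thesis
    using assms by (simp add: Fr_C_def orbit_cls[OF assms(1)] Fr_X_cls)
qed

lemma Fr_C_canon:
  assumes "odd n"
  shows "Fr_C n (canon P) = orbit (cls (\<i> ^ n) (P1_pow P n))"
  using Fr_C_orbit[of \<i> n P] assms by (simp add: canon_eq)

lemma i_power_odd:
  assumes "odd n"
  shows "\<i> ^ n = (if n mod 4 = 1 then \<i> else - \<i>)"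
proof -
  have "\<i> ^ (4 * (n div 4) + n mod 4) = (\<i> ^ 4) ^ (n div 4) * \<i> ^ (n mod 4)"
    by (simp only: power_add power_mult)
  also have "\<i> ^ 4 = 1" by (simp add: power4_eq_xxxx)
  finally have "\<i> ^ n = \<i> ^ (n mod 4)" by simp
  moreover have "n mod 4 = 1 \<or> n mod 4 = 3" using assms by presburger
  ultimately show ?thesis by (auto simp: power3_eq_cube)
qed

lemma monoid_action_Fr_C: "monoid_action N_odd C_inf Fr_C"
proof -
  have "Fr_C m Q \<in> C_inf" if "odd m" "Q \<in> C_inf" for m Q
    using that orbit_cases[OF root_power[of \<i> m]]
    by (auto simp: C_inf_eq Fr_C_canon)
  moreover have "Fr_C 1 Q = Q" if Q: "Q \<in> C_inf" for Q
  proof -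
    obtain P where P: "Q = canon P" using Q by (auto simp: C_inf_eq)
    show ?thesis unfolding P using Fr_C_canon[of 1 P] canon_eq[of P] by (simp add: P1_pow_1)
  qed
  moreover have "Fr_C (m * n) Q = Fr_C m (Fr_C n Q)" if "odd m" "odd n" and Q: "Q \<in> C_inf" for m n Q
  proof -
    obtain P where P: "Q = canon P" using Q by (auto simp: C_inf_eq)
    have "\<i> ^ (m * n) = (\<i> ^ n) ^ m" by (metis mult.commute power_mult)
    then show ?thesis
      using that Fr_C_orbit[OF root_power[of \<i> n]] by (simp add: P Fr_C_canon P1_pow_mult)
  qed
  ultimately show ?thesis by (auto simp: monoid_action_def N_odd_def)
qed

section \<open>The real structure on orbits\<close>

lemma sigma_C_canon: "sigma_C (canon P) = canon (sigma P)"
  by (simp add: sigma_C_def inv_into_f_f[OF inj_canon])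

text \<open>\<open>sigma_C\<close> is defined through the root \<open>\<i>\<close>, yet has the same
  form over \<open>- \<i>\<close> because -1/z commutes with conjugation.\<close>

lemma sigma_C_orbit:
  assumes "j * j = - 1"
  shows "sigma_C (orbit (cls j P)) = orbit (cls j (sigma P))"
  using assms by (simp add: orbit_cases sigma_C_canon sigma_def antip_cnj)

lemma P1_pow_sigma: "odd n \<Longrightarrow> P1_pow (sigma P) n = sigma (P1_pow P n)"
  by (simp add: sigma_def P1_pow_antip P1_pow_cnj)

theorem proposition7p5:
  shows "bij_betw canon UNIV C_inf \<and>
    (\<forall>n\<in>carrier N_odd. sheaf_endo (Fr n)) \<and>
    monoid_action N_odd C_inf Fr_C \<and>
    (\<forall>n\<in>carrier N_odd. \<forall>z.
       (n mod 4 = 1 \<longrightarrow> Fr_C n (canon z) = canon (P1_pow z n)) \<and>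
       (n mod 4 = 3 \<longrightarrow> Fr_C n (canon z) = canon (P1_neg (P1_inv (P1_pow z n))))) \<and>
    (\<forall>n\<in>carrier N_odd. \<forall>Q\<in>C_inf. Fr_C n (sigma_C Q) = sigma_C (Fr_C n Q))"
proof (intro conjI ballI allI impI)
  show "bij_betw canon UNIV C_inf"
    using inj_canon by (simp add: bij_betw_def C_inf_eq)
  show "monoid_action N_odd C_inf Fr_C" by (rule monoid_action_Fr_C)
next
  fix n assume "n \<in> carrier N_odd"
  then have n: "odd n" by (simp add: N_odd_def)
  show "sheaf_endo (Fr n)" using n by (rule sheaf_endo_Fr)
  show "Fr_C n (canon z) = canon (P1_pow z n)" if "n mod 4 = 1" for z
    unfolding Fr_C_canon[OF n] i_power_odd[OF n] that by (simp add: canon_eq)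
  \<comment> \<open>Here \<open>\<i> ^ n\<close> is \<open>- \<i>\<close>, and returning to
    \<open>\<i>\<close> by \<open>orbit_antip\<close> introduces the map -1/z.\<close>
  show "Fr_C n (canon z) = canon (antip (P1_pow z n))" if "n mod 4 = 3" for z
    unfolding Fr_C_canon[OF n] i_power_odd[OF n] that using orbit_antip[of \<i>]
    by (simp add: canon_eq)
  fix Q assume "Q \<in> C_inf"
  then obtain P where "Q = canon P" by (auto simp: C_inf_eq)
  then show "Fr_C n (sigma_C Q) = sigma_C (Fr_C n Q)"
    \<comment> \<open>The Frobenius image has root \<open>\<i> ^ n\<close>, so
      \<open>sigma_C\<close> is needed over either root.\<close>
    using n sigma_C_orbit[OF root_power[of \<i> n]]
    by (simp add: sigma_C_canon Fr_C_canon P1_pow_sigma)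
qed

end
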